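(* Let $X$ and $Y$ be two finite metric spaces with $\#X=m$ and $\#Y=n$, and let $p\in(1,\infty]$. Then $$d_{\mathrm{GH}}(\mathfrak{S}_p(X),\mathfrak{S}_p(Y))\leq \left(\max(m,n)-1\right)^{\frac{1}{p}}\,d_{\mathrm{GH}}(X,Y).$$
   Context: All metric spaces are nonempty. Convention: $\frac1\infty=0$, so that the factor $(\max(m,n)-1)^{1/p}$ is $1$ when $p=\infty$. $d_{\mathrm{GH}}$ is the usual Gromov-Hausdorff distance: $d_{\mathrm{GH}}(X,Y)=\frac12\inf_R\sup_{(x,y),(x',y')\in R}|d_X(x,x')-d_Y(y,y')|$ over all correspondences $R\subseteq X\times Y$ (subsets projecting onto both $X$ and $Y$). For $a,b\ge 0$ put $a\boxplus_p b=(a^p+b^p)^{1/p}$ if $p\in[1,\infty)$ and $a\boxplus_\infty b=\max(a,b)$; this operation is associative and commutative. For a compact metric space $(X,d_X)$ and $p\in[1,\infty]$ let $$d_X^{(p)}(x,x')=\inf\{d_X(x_0,x_1)\boxplus_p d_X(x_1,x_2)\boxplus_p\cdots\boxplus_p d_X(x_{n-1},x_n)\},$$ the infimum being over all finite sequences $x=x_0,x_1,\dots,x_n=x'$ in $X$. This is a pseudometric, and $\mathfrak{S}_p(X)$ is the metric space obtained from $(X,d_X^{(p)})$ by identifying points at $d_X^{(p)}$-distance $0$. If $X$ is finite, $\mathfrak{S}_p(X)=(X,d_X^{(p)})$. *)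

theory Defs
  imports "HOL-Analysis.Analysis"
begin

section \<open>The spaces \<open>\<SS>\<^sub>p(X)\<close>\<close>

definition boxplus :: "ereal \<Rightarrow> real \<Rightarrow> real \<Rightarrow> real" where
  "boxplus p a b =
     (if p = \<infinity> then max a b
      else (a powr real_of_ereal p + b powr real_of_ereal p) powr (1 / real_of_ereal p))"

text \<open>The operation is associative with neutral element 0 on the nonnegative reals (see below),
  so the cost of a chain can be computed by recursion from the right.\<close>

fun chain_cost :: "ereal \<Rightarrow> ('a \<Rightarrow> 'a \<Rightarrow> real) \<Rightarrow> 'a list \<Rightarrow> real" where
  "chain_cost p d (x # y # zs) = boxplus p (d x y) (chain_cost p d (y # zs))"
| "chain_cost p d _ = 0"

text \<open>The list \<open>zs\<close> consists of the intermediate points of a chain from \<open>x\<close> to \<open>x'\<close>.\<close>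

definition chain_dist :: "ereal \<Rightarrow> 'a metric \<Rightarrow> 'a \<Rightarrow> 'a \<Rightarrow> real" where
  "chain_dist p X x x' =
     (INF zs\<in>lists (mspace X). chain_cost p (mdist X) (x # zs @ [x']))"

definition chain_rel :: "ereal \<Rightarrow> 'a metric \<Rightarrow> ('a \<times> 'a) set" where
  "chain_rel p X = {(x, x') \<in> mspace X \<times> mspace X. chain_dist p X x x' = 0}"

text \<open>The distance of two classes is computed on arbitrary representatives; see
  \<open>mspace_Sp\<close> and \<open>mdist_Sp\<close> below for well-definedness.\<close>

definition Sp :: "ereal \<Rightarrow> 'a metric \<Rightarrow> 'a set metric" where
  "Sp p X =
     metric (mspace X // chain_rel p X,
             \<lambda>A B. chain_dist p X (SOME x. x \<in> A) (SOME y. y \<in> B))"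


section \<open>The Gromov--Hausdorff distance\<close>

definition correspondences :: "'a set \<Rightarrow> 'b set \<Rightarrow> ('a \<times> 'b) set set" where
  "correspondences A B = {R. R \<subseteq> A \<times> B \<and> fst ` R = A \<and> snd ` R = B}"

text \<open>Extended nonnegative reals are used so that the supremum and the infimum exist for all
  (possibly unbounded) metric spaces.\<close>

definition dGH :: "'a metric \<Rightarrow> 'b metric \<Rightarrow> ennreal" where
  "dGH X Y =
     (INF R\<in>correspondences (mspace X) (mspace Y).
        SUP ((x, y), (x', y'))\<in>R \<times> R. ennreal \<bar>mdist X x x' - mdist Y y y'\<bar>) / 2"


section \<open>Well-definedness of \<open>\<SS>\<^sub>p(X)\<close>\<close>

lemma boxplus_nonneg: "a \<ge> 0 \<Longrightarrow> b \<ge> 0 \<Longrightarrow> boxplus p a b \<ge> 0"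
  by (auto simp: boxplus_def)

lemma boxplus_commute: "boxplus p a b = boxplus p b a"
  by (auto simp: boxplus_def max.commute add.commute)

lemma ereal_ge_1_cases:
  assumes "1 \<le> (p :: ereal)"
  obtains "p = \<infinity>" | q where "p = ereal q" "1 \<le> q"
  using assms by (cases p) (auto simp: one_ereal_def)

lemma boxplus_0:
  assumes "1 \<le> p" "a \<ge> 0"
  shows "boxplus p 0 a = a" "boxplus p a 0 = a"
  using assms by (auto elim!: ereal_ge_1_cases simp: boxplus_def powr_powr)

lemma boxplus_assoc:
  assumes "1 \<le> p" "a \<ge> 0" "b \<ge> 0" "c \<ge> 0"
  shows "boxplus p (boxplus p a b) c = boxplus p a (boxplus p b c)"
  using assms
  by (auto elim!: ereal_ge_1_cases simp: boxplus_def powr_powr max.assoc add.assoc)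

lemma boxplus_le_add:
  assumes "1 \<le> p" "a \<ge> 0" "b \<ge> 0"
  shows "boxplus p a b \<le> a + b"
  using assms(1)
proof (cases rule: ereal_ge_1_cases)
  case 1
  then show ?thesis using assms by (simp add: boxplus_def)
next
  case (2 q)
  have split: "c powr q = c * c powr (q - 1)" if "c \<ge> 0" for c :: real
    using that 2 by (cases "c = 0") (auto simp: powr_mult_base)
  have "a powr q + b powr q = a * a powr (q - 1) + b * b powr (q - 1)"
    using split assms by simp
  also have "\<dots> \<le> a * (a + b) powr (q - 1) + b * (a + b) powr (q - 1)"
    using assms 2 by (intro add_mono mult_left_mono powr_mono2) auto
  also have "\<dots> = (a + b) powr q"
    using split[of "a + b"] assms by (simp add: distrib_right)
  finally have "(a powr q + b powr q) powr (1 / q) \<le> ((a + b) powr q) powr (1 / q)"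
    using 2 by (intro powr_mono2) auto
  also have "\<dots> = a + b"
    using 2 assms by (simp add: powr_powr)
  finally show ?thesis using 2 by (simp add: boxplus_def)
qed

context
  fixes p :: ereal and X :: "'a metric"
  assumes p: "1 \<le> p"
begin

lemma chain_cost_nonneg: "chain_cost p (mdist X) xs \<ge> 0"
  by (induction p "mdist X" xs rule: chain_cost.induct) (auto intro: boxplus_nonneg)

lemma chain_cost_append:
  "chain_cost p (mdist X) (xs @ y # ys) =
     boxplus p (chain_cost p (mdist X) (xs @ [y])) (chain_cost p (mdist X) (y # ys))"
proof (induction xs)
  case Nil
  then show ?case by (simp add: boxplus_0 p chain_cost_nonneg)
next
  case (Cons x xs)
  then show ?case
    by (cases xs) (auto simp: boxplus_0 boxplus_assoc p chain_cost_nonneg)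
qed

lemma chain_cost_rev: "chain_cost p (mdist X) (rev xs) = chain_cost p (mdist X) xs"
proof (induction xs rule: induct_list012)
  case (3 x y zs)
  have "chain_cost p (mdist X) (rev (x # y # zs)) =
          boxplus p (chain_cost p (mdist X) (rev (y # zs))) (chain_cost p (mdist X) [y, x])"
    using chain_cost_append[of "rev zs" y "[x]"] by simp
  then show ?case
    using 3 by (simp add: boxplus_commute boxplus_0 p mdist_commute)
qed auto

lemma chain_bdd: "bdd_below ((\<lambda>zs. chain_cost p (mdist X) (x # zs @ [y])) ` lists (mspace X))"
  using chain_cost_nonneg by (intro bdd_belowI2) blast

lemma chain_dist_le:
  "zs \<in> lists (mspace X) \<Longrightarrow> chain_dist p X x y \<le> chain_cost p (mdist X) (x # zs @ [y])"
  unfolding chain_dist_def by (intro cINF_lower chain_bdd)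

lemma chain_dist_nonneg: "chain_dist p X x y \<ge> 0"
  unfolding chain_dist_def by (intro cINF_greatest chain_cost_nonneg) auto

lemma chain_dist_le_mdist: "chain_dist p X x y \<le> mdist X x y"
  using chain_dist_le[of "[]" x y] by (simp add: boxplus_0 p)

lemma chain_dist_commute: "chain_dist p X x y = chain_dist p X y x"
proof -
  have "chain_dist p X x y \<le> chain_dist p X y x" for x y
    unfolding chain_dist_def[of p X y x]
  proof (rule cINF_greatest)
    fix zs assume zs: "zs \<in> lists (mspace X)"
    have "chain_dist p X x y \<le> chain_cost p (mdist X) (x # rev zs @ [y])"
      using zs by (intro chain_dist_le) auto
    also have "\<dots> = chain_cost p (mdist X) (y # zs @ [x])"
      using chain_cost_rev[of "y # zs @ [x]"] by simp
    finally show "chain_dist p X x y \<le> chain_cost p (mdist X) (y # zs @ [x])" .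
  qed auto
  then show ?thesis by (meson antisym)
qed

lemma chain_dist_refl:
  assumes "x \<in> mspace X"
  shows "chain_dist p X x x = 0"
proof (rule antisym)
  show "chain_dist p X x x \<le> 0"
    using chain_dist_le_mdist[of x x] mdist_zero[OF assms assms] by simp
qed (rule chain_dist_nonneg)

lemma chain_dist_triangle:
  assumes y: "y \<in> mspace X"
  shows "chain_dist p X x z \<le> chain_dist p X x y + chain_dist p X y z"
proof -
  have *: "chain_dist p X x z \<le>
           chain_cost p (mdist X) (x # as @ [y]) + chain_cost p (mdist X) (y # bs @ [z])"
    if "as \<in> lists (mspace X)" "bs \<in> lists (mspace X)" for as bs
  proof -
    have "chain_dist p X x z \<le> chain_cost p (mdist X) (x # (as @ y # bs) @ [z])"
      using that y by (intro chain_dist_le) auto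
    also have "\<dots> = boxplus p (chain_cost p (mdist X) (x # as @ [y]))
                              (chain_cost p (mdist X) (y # bs @ [z]))"
      using chain_cost_append[of "x # as" y "bs @ [z]"] by simp
    also have "\<dots> \<le> chain_cost p (mdist X) (x # as @ [y]) + chain_cost p (mdist X) (y # bs @ [z])"
      by (intro boxplus_le_add p chain_cost_nonneg)
    finally show ?thesis .
  qed
  have "chain_dist p X x z - chain_dist p X y z \<le> chain_cost p (mdist X) (x # as @ [y])"
    if as: "as \<in> lists (mspace X)" for as
  proof -
    have "chain_dist p X x z - chain_cost p (mdist X) (x # as @ [y]) \<le> chain_dist p X y z"
      unfolding chain_dist_def[of p X y z]
    proof (rule cINF_greatest)
      fix bs assume "bs \<in> lists (mspace X)"
      then show "chain_dist p X x z - chain_cost p (mdist X) (x # as @ [y])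
                   \<le> chain_cost p (mdist X) (y # bs @ [z])"
        using *[OF as] by fastforce
    qed auto
    then show ?thesis by linarith
  qed
  then have "chain_dist p X x z - chain_dist p X y z \<le> chain_dist p X x y"
    unfolding chain_dist_def[of p X x y] by (intro cINF_greatest) auto
  then show ?thesis by linarith
qed

lemma equiv_chain_rel: "equiv (mspace X) (chain_rel p X)"
proof (rule equivI)
  show "trans (chain_rel p X)"
  proof (rule transI)
    fix x y z assume "(x, y) \<in> chain_rel p X" "(y, z) \<in> chain_rel p X"
    then show "(x, z) \<in> chain_rel p X"
      using chain_dist_triangle[of y x z] chain_dist_nonneg[of x z]
      by (auto simp: chain_rel_def)
  qed
qed (auto simp: chain_rel_def refl_on_def sym_def chain_dist_refl chain_dist_commute)

lemma chain_dist_cong: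
  assumes "(x, x') \<in> chain_rel p X" "(y, y') \<in> chain_rel p X"
  shows "chain_dist p X x y = chain_dist p X x' y'"
proof -
  have "chain_dist p X x y \<le> chain_dist p X x' y'"
    if "(x, x') \<in> chain_rel p X" "(y, y') \<in> chain_rel p X" for x x' y y'
    using that chain_dist_triangle[of x' x y] chain_dist_triangle[of y' x' y]
      chain_dist_commute[of y y'] by (auto simp: chain_rel_def)
  moreover have "(x', x) \<in> chain_rel p X" "(y', y) \<in> chain_rel p X"
    using assms equiv_chain_rel by (auto dest: equivE symD)
  ultimately show ?thesis using assms by (meson antisym)
qed

lemma some_in_class:
  assumes "A \<in> mspace X // chain_rel p X"
  shows "(SOME x. x \<in> A) \<in> A" "A \<subseteq> mspace X"
  using assms in_quotient_imp_non_empty[OF equiv_chain_rel assms]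
    in_quotient_imp_subset[OF equiv_chain_rel assms]
  by (auto simp: some_in_eq)

lemma Metric_space_Sp:
  "Metric_space (mspace X // chain_rel p X)
     (\<lambda>A B. chain_dist p X (SOME x. x \<in> A) (SOME y. y \<in> B))"
proof
  fix A B assume AB: "A \<in> mspace X // chain_rel p X" "B \<in> mspace X // chain_rel p X"
  define a b where "a = (SOME x. x \<in> A)" and "b = (SOME x. x \<in> B)"
  have ab: "a \<in> A" "b \<in> B" "a \<in> mspace X" "b \<in> mspace X"
    using AB some_in_class unfolding a_def b_def by blast+
  have "chain_dist p X a b = 0 \<longleftrightarrow> (a, b) \<in> chain_rel p X"
    using ab by (simp add: chain_rel_def)
  also have "\<dots> \<longleftrightarrow> A = B"
    using quotient_eq_iff[OF equiv_chain_rel AB ab(1,2)] by simp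
  finally show "chain_dist p X (SOME x. x \<in> A) (SOME y. y \<in> B) = 0 \<longleftrightarrow> A = B"
    by (simp add: a_def b_def)
next
  fix A B C assume "B \<in> mspace X // chain_rel p X"
  then show "chain_dist p X (SOME x. x \<in> A) (SOME y. y \<in> C) \<le>
        chain_dist p X (SOME x. x \<in> A) (SOME y. y \<in> B) +
        chain_dist p X (SOME x. x \<in> B) (SOME y. y \<in> C)"
    using some_in_class by (intro chain_dist_triangle) blast
qed (auto simp: chain_dist_nonneg chain_dist_commute)

lemma mspace_Sp: "mspace (Sp p X) = mspace X // chain_rel p X"
  unfolding Sp_def by (rule Metric_space.mspace_metric[OF Metric_space_Sp])

lemma mdist_Sp:
  assumes "x \<in> mspace X" "y \<in> mspace X"
  shows "mdist (Sp p X) (chain_rel p X `` {x}) (chain_rel p X `` {y}) = chain_dist p X x y"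
proof -
  have "(x, SOME u. u \<in> chain_rel p X `` {x}) \<in> chain_rel p X" if "x \<in> mspace X" for x
    using some_in_class(1)[OF quotientI[OF that]] by simp
  with assms show ?thesis
    unfolding Sp_def Metric_space.mdist_metric[OF Metric_space_Sp]
    using chain_dist_cong by metis
qed

end

end

theory Submission
  imports Defs
begin

text \<open>An optimal chain in a finite space may be taken without repeated points, so it has at most
  \<open>card - 1\<close> steps. Transporting it through a correspondence of distortion \<open>\<epsilon>\<close> increases each of
  its \<open>k\<close> steps by at most \<open>\<epsilon>\<close>; by Minkowski's inequality in \<open>\<ell>\<^sup>p\<close> the cost of the chain then
  increases by at most \<open>k\<^sup>1\<^sup>/\<^sup>p \<epsilon>\<close>.\<close>

section \<open>The cost of a chain of equal steps\<close>

text \<open>The \<open>p\<close>-norm of a vector of \<open>k\<close> ones. At \<open>k = 0\<close>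
  the value is 0 for finite \<open>p\<close>, but still 1 for \<open>p = \<infinity>\<close>, by the
  convention that \<open>1/\<infinity>\<close> is 0.\<close>

definition chain_factor :: "ereal \<Rightarrow> nat \<Rightarrow> real" where
  "chain_factor p k = (if p = \<infinity> then 1 else real k powr (1 / real_of_ereal p))"

lemma chain_factor_nonneg: "0 \<le> chain_factor p k"
  by (simp add: chain_factor_def)

lemma chain_factor_mono:
  assumes "1 \<le> p" "j \<le> k"
  shows "chain_factor p j \<le> chain_factor p k"
  using assms(1) by (cases rule: ereal_ge_1_cases) (use assms in \<open>simp_all add: chain_factor_def powr_mono2\<close>)

lemma chain_factor_1: "chain_factor p 1 = 1"
  by (simp add: chain_factor_def)

lemma boxplus_mono:
  assumes "1 \<le> p" "0 \<le> a" "a \<le> a'" "0 \<le> b" "b \<le> b'"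
  shows "boxplus p a b \<le> boxplus p a' b'"
  using assms(1)
proof (cases rule: ereal_ge_1_cases)
  case (2 q)
  then have "(a powr q + b powr q) powr (1 / q) \<le> (a' powr q + b' powr q) powr (1 / q)"
    using assms by (intro powr_mono2 add_mono) auto
  then show ?thesis using 2 by (simp add: boxplus_def)
qed (use assms in \<open>auto simp: boxplus_def\<close>)

text \<open>One more entry \<open>e\<close> raises the sum of \<open>q\<close>-th powers from
  \<open>k * e powr q\<close> to \<open>Suc k * e powr q\<close>; for \<open>p = \<infinity>\<close>
  the maximum stays \<open>e\<close>.\<close>

lemma boxplus_chain_factor:
  assumes "1 \<le> p" "0 \<le> e"
  shows "boxplus p e (chain_factor p k * e) \<le> chain_factor p (Suc k) * e"
  using assms(1)
proof (cases rule: ereal_ge_1_cases)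
  case (2 q)
  have "e powr q + (real k powr (1 / q) * e) powr q = real (Suc k) * e powr q"
    using 2 assms(2) by (simp add: powr_mult powr_powr algebra_simps)
  then show ?thesis
    using 2 assms(2) by (simp add: boxplus_def chain_factor_def powr_mult powr_powr)
qed (simp add: boxplus_def chain_factor_def)

section \<open>Convexity and Minkowski's inequality\<close>

lemma convex_on_powr_nonneg:
  fixes q :: real
  assumes q: "1 \<le> q"
  shows "convex_on {0..} (\<lambda>x. x powr q)"
proof (rule convex_onI)
  fix t x y :: real
  assume t: "0 < t" "t < 1" and xy: "x \<in> {0..}" "y \<in> {0..}"
  have le: "u powr q \<le> u" if "0 < u" "u < 1" for u :: real
    using powr_mono'[of 1 q u] that q by simp
  \<comment> \<open>For two positive points this is \<open>powr_convex\<close>. If one point is 0,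
    its term vanishes and \<open>le\<close>, applied to the weight of the other point, gives the
    bound.\<close>
  show "((1 - t) *\<^sub>R x + t *\<^sub>R y) powr q \<le> (1 - t) * x powr q + t * y powr q"
  proof (cases "x = 0 \<or> y = 0")
    case True
    then show ?thesis
      using t xy le[of t] le[of "1 - t"] by (auto simp: powr_mult intro!: mult_right_mono)
  next
    case False
    then show ?thesis
      using convex_onD[OF powr_convex[OF q], of t x y] t xy by simp
  qed
qed auto

text \<open>Minkowski's inequality in the plane. After normalising both vectors to unit length it is the
  convexity of \<open>t powr q\<close>.\<close>

lemma boxplus_add_le:
  assumes p: "1 \<le> p" and nn: "0 \<le> a" "0 \<le> b" "0 \<le> c" "0 \<le> d"
  shows "boxplus p (a + c) (b + d) \<le> boxplus p a b + boxplus p c d"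
  using p
proof (cases rule: ereal_ge_1_cases)
  case (2 q)
  define A B where "A = boxplus p a b" and "B = boxplus p c d"
  have A0: "A \<ge> 0" and B0: "B \<ge> 0"
    using nn by (simp_all add: A_def B_def boxplus_nonneg)
  have Aq: "A powr q = a powr q + b powr q" and Bq: "B powr q = c powr q + d powr q"
    using 2 by (simp_all add: A_def B_def boxplus_def powr_powr)
  show ?thesis
  proof (cases "A = 0 \<or> B = 0")
    \<comment> \<open>Zero vectors cannot be normalised; by \<open>Aq\<close> and \<open>Bq\<close>
      a vanishing norm forces both entries to vanish.\<close>
    case True
    then have "a = 0 \<and> b = 0 \<or> c = 0 \<and> d = 0"
      using Aq Bq 2 by (auto simp: add_nonneg_eq_0_iff)
    then show ?thesis
      using A0 B0 by (auto simp: A_def B_def)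
  next
    case False
    then have A: "A > 0" and B: "B > 0" using A0 B0 by auto
    \<comment> \<open>This weight makes \<open>(x + y) / (A + B)\<close> a convex combination of
      \<open>x / A\<close> and \<open>y / B\<close>. Since \<open>(a / A, b / A)\<close> and
      \<open>(c / B, d / B)\<close> have norm 1, the bounds for the two coordinates add up to
      \<open>l + (1 - l) = 1\<close>.\<close>
    define l where "l = A / (A + B)"
    have l: "0 \<le> l" "l \<le> 1" and l1: "1 - l = B / (A + B)"
      using A B by (auto simp: l_def field_simps)
    have step: "((x + y) / (A + B)) powr q \<le> l * (x / A) powr q + (1 - l) * (y / B) powr q"
      if "x \<ge> 0" "y \<ge> 0" for x y
    proof -
      have "(x + y) / (A + B) = l * (x / A) + (1 - l) * (y / B)"
        using A B unfolding l1 by (simp add: l_def add_divide_distrib)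
      moreover have "convex_on {0..} (\<lambda>t. t powr q)"
        using 2 by (intro convex_on_powr_nonneg)
      ultimately show ?thesis
        using convex_onD[of "{0..}" "\<lambda>t. t powr q" "1 - l" "x / A" "y / B"] l that A B by simp
    qed
    have "((a + c) powr q + (b + d) powr q) / (A + B) powr q =
        ((a + c) / (A + B)) powr q + ((b + d) / (A + B)) powr q"
      using nn A B by (simp add: powr_divide[of "_ + _" "_ + _"] add_divide_distrib[of "_ powr _"])
    also have "\<dots> \<le> l * ((a / A) powr q + (b / A) powr q) +
        (1 - l) * ((c / B) powr q + (d / B) powr q)"
      using step[OF nn(1,3)] step[OF nn(2,4)] by (simp add: algebra_simps)
    also have "(a / A) powr q + (b / A) powr q = 1"
      using nn A by (simp add: powr_divide add_divide_distrib[symmetric] flip: Aq)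
    also have "(c / B) powr q + (d / B) powr q = 1"
      using nn B by (simp add: powr_divide add_divide_distrib[symmetric] flip: Bq)
    finally have "(a + c) powr q + (b + d) powr q \<le> (A + B) powr q"
      using A B by (simp add: divide_le_eq)
    then have "((a + c) powr q + (b + d) powr q) powr (1 / q) \<le> ((A + B) powr q) powr (1 / q)"
      using 2 by (intro powr_mono2) auto
    then show ?thesis
      using 2 A B unfolding A_def[symmetric] B_def[symmetric] by (simp add: boxplus_def powr_powr)
  qed
qed (use nn in \<open>auto simp: boxplus_def max_def\<close>)

section \<open>Chains without repeated points\<close>

text \<open>Replacing the nonnegative cost of the initial segment by the neutral element 0 can only
  lower the total.\<close>

lemma chain_cost_append_ge:
  assumes "1 \<le> p"
  shows "chain_cost p (mdist X) (y # ys) \<le> chain_cost p (mdist X) (xs @ y # ys)"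
proof -
  have "chain_cost p (mdist X) (y # ys) = boxplus p 0 (chain_cost p (mdist X) (y # ys))"
    by (simp add: boxplus_0 assms chain_cost_nonneg)
  also have "\<dots> \<le> boxplus p (chain_cost p (mdist X) (xs @ [y])) (chain_cost p (mdist X) (y # ys))"
    by (intro boxplus_mono assms chain_cost_nonneg order_refl)
  also have "\<dots> = chain_cost p (mdist X) (xs @ y # ys)"
    by (rule chain_cost_append[OF assms, symmetric])
  finally show ?thesis .
qed

text \<open>Loops are cut out, building the chain from its end: when the new head already occurs,
  everything before that occurrence is dropped. If the endpoints of \<open>xs\<close> coincide, only
  a single point remains.\<close>

lemma distinct_chain:
  assumes p: "1 \<le> p" and "xs \<noteq> []"
  shows "\<exists>ws. ws \<noteq> [] \<and> hd ws = hd xs \<and> last ws = last xs \<and> set ws \<subseteq> set xs \<and> distinct ws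
           \<and> chain_cost p (mdist X) ws \<le> chain_cost p (mdist X) xs"
  using assms(2)
proof (induction xs rule: list_nonempty_induct)
  case (single x)
  then show ?case by (intro exI[of _ "[x]"]) auto
next
  case (cons x xs)
  then obtain ws where ws: "ws \<noteq> []" "hd ws = hd xs" "last ws = last xs" "set ws \<subseteq> set xs"
      "distinct ws" "chain_cost p (mdist X) ws \<le> chain_cost p (mdist X) xs"
    by blast
  have "chain_cost p (mdist X) (x # ws) = boxplus p (mdist X x (hd ws)) (chain_cost p (mdist X) ws)"
    using ws(1) by (cases ws) auto
  also have "\<dots> \<le> boxplus p (mdist X x (hd xs)) (chain_cost p (mdist X) xs)"
    using ws by (intro boxplus_mono p chain_cost_nonneg) auto
  also have "\<dots> = chain_cost p (mdist X) (x # xs)"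
    using cons.hyps by (cases xs) auto
  finally have le: "chain_cost p (mdist X) (x # ws) \<le> chain_cost p (mdist X) (x # xs)" .
  show ?case
  proof (cases "x \<in> set ws")
    case False
    then show ?thesis
      using ws le cons.hyps by (intro exI[of _ "x # ws"]) auto
  next
    case True
    then obtain as bs where ab: "ws = as @ x # bs"
      by (meson split_list)
    \<comment> \<open>The chain \<open>x # ws\<close> runs through \<open>as\<close> and returns to
      \<open>x\<close>; this loop is discarded.\<close>
    have "chain_cost p (mdist X) (x # bs) \<le> chain_cost p (mdist X) (x # xs)"
      using chain_cost_append_ge[OF p, of X x bs "x # as"] le ab by simp
    then show ?thesis
      using ws ab cons.hyps by (intro exI[of _ "x # bs"]) auto
  qed
qed

section \<open>Transporting chains through a correspondence\<close>

text \<open>The list \<open>ws\<close> has \<open>length ws - 1\<close> steps. At each of them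
  Minkowski's inequality separates the error \<open>e\<close> from the original step length, and the
  errors accumulate as the norm of a constant vector.\<close>

lemma chain_cost_map_le:
  assumes p: "1 \<le> p" and e: "0 \<le> e"
    and f: "\<And>u v. u \<in> set ws \<Longrightarrow> v \<in> set ws \<Longrightarrow> mdist Y (f u) (f v) \<le> mdist X u v + e"
  shows "chain_cost p (mdist Y) (map f ws)
           \<le> chain_cost p (mdist X) ws + chain_factor p (length ws - 1) * e"
  using f
proof (induction ws rule: induct_list012)
  case (3 x y zs)
  let ?C = "chain_cost p (mdist X) (y # zs)" and ?k = "length zs"
  have "chain_cost p (mdist Y) (map f (x # y # zs)) =
      boxplus p (mdist Y (f x) (f y)) (chain_cost p (mdist Y) (map f (y # zs)))"
    by simp
  also have "\<dots> \<le> boxplus p (mdist X x y + e) (?C + chain_factor p ?k * e)"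
    using 3 by (intro boxplus_mono p chain_cost_nonneg) auto
  also have "\<dots> \<le> boxplus p (mdist X x y) ?C + boxplus p e (chain_factor p ?k * e)"
    using e by (intro boxplus_add_le p chain_cost_nonneg mult_nonneg_nonneg chain_factor_nonneg) auto
  also have "\<dots> \<le> boxplus p (mdist X x y) ?C + chain_factor p (Suc ?k) * e"
    using boxplus_chain_factor[OF p e] by simp
  finally show ?case by simp
\<comment> \<open>Lists with at most one point cost 0, so a nonnegative factor suffices.\<close>
qed (use e chain_factor_nonneg in auto)

text \<open>Every chain from \<open>x\<close> to \<open>x'\<close> is first made distinct, then
  mapped by a selection from \<open>R\<close> that respects both prescribed endpoint pairs. The
  resulting bound passes to the infimum over chains.\<close>

lemma chain_dist_le_transport:
  assumes p: "1 \<le> p" and fin: "finite (mspace X)" and e: "0 \<le> e"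
    and R: "fst ` R = mspace X" "snd ` R \<subseteq> mspace Y"
    and dis: "\<And>u v u' v'. (u, v) \<in> R \<Longrightarrow> (u', v') \<in> R \<Longrightarrow> mdist Y v v' \<le> mdist X u u' + e"
    and xy: "(x, y) \<in> R" "(x', y') \<in> R" and ne: "x \<noteq> x'"
  shows "chain_dist p Y y y' \<le> chain_dist p X x x' + chain_factor p (card (mspace X) - 1) * e"
proof -
  have "\<forall>u\<in>mspace X. \<exists>v. (u, v) \<in> R"
    unfolding R(1)[symmetric] by auto
  then obtain g where g: "(u, g u) \<in> R" if "u \<in> mspace X" for u
    by metis
  \<comment> \<open>The two prescribed values are compatible because \<open>x\<close> and
    \<open>x'\<close> differ.\<close>
  define f where "f = g(x := y, x' := y')"
  have fR: "(u, f u) \<in> R" if "u \<in> mspace X" for u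
    using g[OF that] xy by (auto simp: f_def)
  have f_in: "f u \<in> mspace Y" if "u \<in> mspace X" for u
    using fR[OF that] R(2) by auto
  have xX: "x \<in> mspace X" "x' \<in> mspace X"
    using xy unfolding R(1)[symmetric] by force+
  have "chain_dist p Y y y' - chain_factor p (card (mspace X) - 1) * e
      \<le> chain_cost p (mdist X) (x # zs @ [x'])" if zs: "zs \<in> lists (mspace X)" for zs
  proof -
    obtain ws where ws: "ws \<noteq> []" "hd ws = x" "last ws = x'" "set ws \<subseteq> set (x # zs @ [x'])"
        "distinct ws" "chain_cost p (mdist X) ws \<le> chain_cost p (mdist X) (x # zs @ [x'])"
      using distinct_chain[OF p, of "x # zs @ [x']" X] by auto
    then have sub: "set ws \<subseteq> mspace X"
      using zs xX by auto
    obtain us where us: "ws = x # us"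
      using ws(1,2) by (cases ws) auto
    then have "us \<noteq> []" "last us = x'"
      using ws(3) ne by auto
    then obtain vs where vs: "ws = x # vs @ [x']"
      using us append_butlast_last_id by metis
    \<comment> \<open>A distinct list has at most as many points as the space, hence at most
      \<open>card (mspace X) - 1\<close> steps.\<close>
    have len: "length ws - 1 \<le> card (mspace X) - 1"
      using card_mono[OF fin sub] by (simp add: distinct_card ws(5))
    have "map f vs \<in> lists (mspace Y)"
      using sub unfolding vs by (auto intro!: f_in)
    moreover have "map f ws = y # map f vs @ [y']"
      using ne by (simp add: vs f_def)
    ultimately have "chain_dist p Y y y' \<le> chain_cost p (mdist Y) (map f ws)"
      using chain_dist_le[OF p] by metis
    also have "\<dots> \<le> chain_cost p (mdist X) ws + chain_factor p (length ws - 1) * e"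
    proof (rule chain_cost_map_le[OF p e])
      fix u v assume "u \<in> set ws" "v \<in> set ws"
      then show "mdist Y (f u) (f v) \<le> mdist X u v + e"
        using sub by (intro dis fR) auto
    qed
    also have "chain_cost p (mdist X) ws + chain_factor p (length ws - 1) * e \<le>
        chain_cost p (mdist X) (x # zs @ [x']) + chain_factor p (card (mspace X) - 1) * e"
      by (intro add_mono mult_right_mono chain_factor_mono chain_factor_nonneg p e ws(6) len)
    finally show ?thesis by simp
  qed
  then have "chain_dist p Y y y' - chain_factor p (card (mspace X) - 1) * e \<le> chain_dist p X x x'"
    unfolding chain_dist_def[of p X] by (intro cINF_greatest) auto
  then show ?thesis by simp
qed

text \<open>The maximum of both cardinalities also covers \<open>x = x'\<close>: then
  \<open>X\<close> may be a single point with factor 0, while \<open>y\<close> and \<open>y'\<close>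
  are different partners of it. In that case \<open>Y\<close> has two points, so the factor is at
  least 1, and the direct step from \<open>y\<close> to \<open>y'\<close> costs at most
  \<open>e\<close>.\<close>

lemma chain_dist_correspondence:
  assumes p: "1 \<le> p" and fin: "finite (mspace X)" "finite (mspace Y)" and e: "0 \<le> e"
    and R: "R \<in> correspondences (mspace X) (mspace Y)"
    and dis: "\<And>u v u' v'. (u, v) \<in> R \<Longrightarrow> (u', v') \<in> R \<Longrightarrow> mdist Y v v' \<le> mdist X u u' + e"
    and xy: "(x, y) \<in> R" "(x', y') \<in> R"
  shows "chain_dist p Y y y' \<le>
    chain_dist p X x x' + chain_factor p (max (card (mspace X)) (card (mspace Y)) - 1) * e"
    (is "_ \<le> _ + chain_factor p ?k * e")
proof (cases "x = x'")
  case False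
  have "chain_dist p Y y y' \<le> chain_dist p X x x' + chain_factor p (card (mspace X) - 1) * e"
    using R dis xy False
    by (intro chain_dist_le_transport[where R = R] p fin e) (auto simp: correspondences_def)
  also have "\<dots> \<le> chain_dist p X x x' + chain_factor p ?k * e"
    by (intro add_left_mono mult_right_mono chain_factor_mono p e) auto
  finally show ?thesis .
next
  case True
  have in_sp: "x \<in> mspace X" "y \<in> mspace Y" "y' \<in> mspace Y"
    using R xy by (auto simp: correspondences_def)
  show ?thesis
  proof (cases "y = y'")
    case True
    then show ?thesis
      using in_sp e by (simp add: chain_dist_refl p chain_dist_nonneg chain_factor_nonneg)
  next
    case False
    have "card {y, y'} \<le> card (mspace Y)"
      using in_sp fin by (intro card_mono) auto
    then have "1 \<le> ?k"
      using False by simp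
    then have "1 * e \<le> chain_factor p ?k * e"
      using chain_factor_mono[OF p, of 1 ?k] e
      by (intro mult_right_mono) (simp_all only: chain_factor_1)
    moreover have "mdist Y y y' \<le> e"
      using dis[OF xy] True mdist_zero[OF in_sp(1,1)] by simp
    ultimately show ?thesis
      using chain_dist_le_mdist[OF p, of Y y y'] chain_dist_nonneg[OF p, of X x x'] by linarith
  qed
qed

section \<open>Passing to the Gromov-Hausdorff distance\<close>

text \<open>Each class has a representative, and each point occurs in \<open>R\<close>, so the
  classes of related points exhaust both quotients.\<close>

lemma Sp_correspondence:
  assumes p: "1 \<le> p" and R: "R \<in> correspondences (mspace X) (mspace Y)"
  shows "(\<lambda>(x, y). (chain_rel p X `` {x}, chain_rel p Y `` {y})) ` R
           \<in> correspondences (mspace (Sp p X)) (mspace (Sp p Y))"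
proof -
  have R': "R \<subseteq> mspace X \<times> mspace Y" "fst ` R = mspace X" "snd ` R = mspace Y"
    using R by (auto simp: correspondences_def)
  show ?thesis
    unfolding correspondences_def mspace_Sp[OF p]
    using R'(1) by (auto simp: quotient_def image_image case_prod_unfold
        simp flip: R'(2,3))
qed

text \<open>Finiteness turns the infimum into a minimum and the supremum into a maximum, so the
  optimal distortion is a real number \<open>e\<close> realised by one correspondence.\<close>

lemma dGH_attained:
  assumes "finite (mspace X)" "mspace X \<noteq> {}" "finite (mspace Y)" "mspace Y \<noteq> {}"
  obtains R e where "R \<in> correspondences (mspace X) (mspace Y)" "0 \<le> e" "dGH X Y = ennreal e / 2"
    "\<And>x y x' y'. (x, y) \<in> R \<Longrightarrow> (x', y') \<in> R \<Longrightarrow> \<bar>mdist X x x' - mdist Y y y'\<bar> \<le> e"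
proof -
  let ?C = "correspondences (mspace X) (mspace Y)"
  let ?g = "\<lambda>((x, y), (x', y')). ennreal \<bar>mdist X x x' - mdist Y y y'\<bar>"
  let ?F = "\<lambda>R. SUP z\<in>R \<times> R. ?g z"
  have "finite ?C"
    using assms by (auto simp: correspondences_def intro!: finite_subset[of _ "Pow (mspace X \<times> mspace Y)"])
  \<comment> \<open>The full product shows that the minimum is over a nonempty set.\<close>
  moreover have "mspace X \<times> mspace Y \<in> ?C"
    using assms by (auto simp: correspondences_def)
  ultimately have "(INF R\<in>?C. ?F R) \<in> ?F ` ?C"
    by (subst cInf_eq_Min) (auto intro!: Min_in)
  then obtain R where R: "R \<in> ?C" "(INF R\<in>?C. ?F R) = ?F R"
    by (metis (no_types, lifting) imageE)
  have "finite R" "R \<noteq> {}"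
    using R(1) assms by (auto simp: correspondences_def intro: finite_subset)
  then have "?F R \<in> ?g ` (R \<times> R)"
    by (subst cSup_eq_Max) (auto intro!: Max_in)
  then obtain x y x' y' where "?F R = ennreal \<bar>mdist X x x' - mdist Y y y'\<bar>"
    by (auto elim!: imageE simp: case_prod_unfold)
  then obtain e where e: "0 \<le> e" "?F R = ennreal e"
    using abs_ge_zero by blast
  show ?thesis
  proof (rule that[OF R(1) e(1)])
    show "dGH X Y = ennreal e / 2"
      unfolding dGH_def R(2) e(2) ..
  next
    fix x y x' y' assume "(x, y) \<in> R" "(x', y') \<in> R"
    then have "?g ((x, y), (x', y')) \<le> ?F R"
      by (intro SUP_upper) auto
    then show "\<bar>mdist X x x' - mdist Y y y'\<bar> \<le> e"
      using e by (simp add: ennreal_le_iff)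
  qed
qed

theorem proposition3p14:
  fixes X :: "'a metric" and Y :: "'b metric" and p :: ereal and m n :: nat
  assumes "finite (mspace X)" and "mspace X \<noteq> {}" and "card (mspace X) = m"
    and "finite (mspace Y)" and "mspace Y \<noteq> {}" and "card (mspace Y) = n"
    and "1 < p"
  shows "dGH (Sp p X) (Sp p Y)
           \<le> ennreal (if p = \<infinity> then 1 else (real (max m n) - 1) powr (1 / real_of_ereal p)) * dGH X Y"
proof -
  have p: "1 \<le> p" using assms by simp
  obtain R e where R: "R \<in> correspondences (mspace X) (mspace Y)" and e: "0 \<le> e"
    and dGH: "dGH X Y = ennreal e / 2"
    and dis: "\<And>x y x' y'. (x, y) \<in> R \<Longrightarrow> (x', y') \<in> R \<Longrightarrow> \<bar>mdist X x x' - mdist Y y y'\<bar> \<le> e"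
    using dGH_attained[OF assms(1,2,4,5)] by blast
  define c where "c = chain_factor p (max m n - 1)"
  \<comment> \<open>Positivity makes the truncated difference \<open>max m n - 1\<close> agree with
    the real one.\<close>
  have "0 < m"
    using assms by (auto simp: card_gt_0_iff)
  then have c_eq: "c = (if p = \<infinity> then 1 else (real (max m n) - 1) powr (1 / real_of_ereal p))"
    by (simp add: c_def chain_factor_def of_nat_diff)
  define Q where "Q = (\<lambda>(x, y). (chain_rel p X `` {x}, chain_rel p Y `` {y})) ` R"
  \<comment> \<open>\<open>chain_dist_correspondence\<close> bounds distances in one direction only;
    the converse relation supplies the other.\<close>
  have conv: "R\<inverse> \<in> correspondences (mspace Y) (mspace X)"
    using R by (auto simp: correspondences_def simp flip: Domain_fst Range_snd)
  have bound: "\<bar>chain_dist p X x x' - chain_dist p Y y y'\<bar> \<le> c * e"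
    if "(x, y) \<in> R" "(x', y') \<in> R" for x y x' y'
  proof -
    have "mdist Y v v' \<le> mdist X u u' + e" if "(u, v) \<in> R" "(u', v') \<in> R" for u v u' v'
      using dis[OF that] by linarith
    then have "chain_dist p Y y y' \<le> chain_dist p X x x' + c * e"
      unfolding c_def assms(3)[symmetric] assms(6)[symmetric]
      by (rule chain_dist_correspondence[OF p assms(1,4) e R]) (use that in auto)
    moreover have "mdist X v v' \<le> mdist Y u u' + e"
      if "(u, v) \<in> R\<inverse>" "(u', v') \<in> R\<inverse>" for u v u' v'
      using dis[of v u v' u'] that by simp
    then have "chain_dist p X x x' \<le> chain_dist p Y y y' + c * e"
      unfolding c_def assms(3)[symmetric] assms(6)[symmetric]
      by (subst max.commute, rule chain_dist_correspondence[OF p assms(4,1) e conv]) (use that in auto)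
    ultimately show ?thesis by linarith
  qed
  have RXY: "x \<in> mspace X" "y \<in> mspace Y" if "(x, y) \<in> R" for x y
    using R that by (auto simp: correspondences_def)
  \<comment> \<open>\<open>Q\<close> is a competitor in the infimum, and by \<open>mdist_Sp\<close>
    its distortion is computed on representatives, where \<open>bound\<close> applies.\<close>
  have "dGH (Sp p X) (Sp p Y) \<le>
      (SUP ((A, B), (A', B'))\<in>Q \<times> Q. ennreal \<bar>mdist (Sp p X) A A' - mdist (Sp p Y) B B'\<bar>) / 2"
    unfolding dGH_def Q_def
    by (intro divide_right_mono_ennreal INF_lower Sp_correspondence p R)
  also have "\<dots> \<le> ennreal (c * e) / 2"
    using bound RXY
    by (intro divide_right_mono_ennreal SUP_least) (auto simp: Q_def mdist_Sp p intro!: ennreal_leI)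
  also have "\<dots> = ennreal c * dGH X Y"
    using e by (simp add: dGH ennreal_mult chain_factor_nonneg c_def ennreal_times_divide)
  finally show ?thesis
    unfolding c_eq .
qed

end
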